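(* Let $(p_i)_{i\ge 1}$ be a sequence of positive real numbers satisfying the following conditions: (1) $p_i\to 0$ as $i\to\infty$; (2) $p_n<\sum_{i=n+1}^\infty p_i$ for all $n\ge 1$; (3) $p_{n-1}<\sum_{i=n+1}^\infty p_i$ for infinitely many $n$; (4) $p_n\le 2p_{n+1}$ for all sufficiently large $n$. Then every real number $x$ with $0<x<S:=\sum_{i=1}^{\infty}p_i$ has a continuum of expansions of the form $$x=\sum_{i=1}^{\infty}c_ip_i,\quad (c_i)\in\{0,1\}^{\mathbb N}.$$
   Context: "A continuum of expansions" means that the set of sequences $(c_i)_{i\ge1}\in\{0,1\}^{\mathbb N}$ with $x=\sum_{i=1}^\infty c_ip_i$ has the cardinality of the continuum. Sums of positive terms are taken in $(0,+\infty]$; convergence of $\sum p_i$ is not among the hypotheses. In condition (3), $n\ge 2$. *)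

theory Defs
  imports "HOL-Analysis.Analysis" "HOL-Library.Equipollence"
begin

text \<open>Sequences are indexed by the positive integers: only the values \<open>p i\<close> with \<open>i \<ge> 1\<close> matter.
  The coefficient sequences are taken extensional outside \<open>{1..}\<close>, so that two of them are equal
  iff they agree at every index \<open>i \<ge> 1\<close>.\<close>

definition expansions :: "(nat \<Rightarrow> real) \<Rightarrow> real \<Rightarrow> (nat \<Rightarrow> nat) set" where
  "expansions p x =
     {c \<in> {1..} \<rightarrow>\<^sub>E {0, 1}. (\<lambda>i. real (c (i + 1)) * p (i + 1)) sums x}"

text \<open>A sum \<open>p\<^sub>n + p\<^sub>n\<^sub>+\<^sub>1 + \<dots>\<close> of nonnegative terms, possibly infinite.
  Note that \<open>ennreal\<close> sends negative reals to \<open>0\<close>.\<close>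

definition tail_sum :: "(nat \<Rightarrow> real) \<Rightarrow> nat \<Rightarrow> ennreal" where
  "tail_sum p n = (\<Sum>i. ennreal (p (n + i)))"

end

theory Submission
  imports Defs
begin

text \<open>Write \<open>y\<^sub>n = x - (c\<^sub>1 p\<^sub>1 + \<dots> + c\<^sub>n p\<^sub>n)\<close> for the remainder after \<open>n\<close> digits and
  \<open>R\<^sub>n = p\<^sub>n\<^sub>+\<^sub>1 + p\<^sub>n\<^sub>+\<^sub>2 + \<dots>\<close> for the tail. Call \<open>y\<^sub>n\<close> admissible if \<open>0 < y\<^sub>n < R\<^sub>n\<close>. From an
  admissible remainder, the next digit \<open>0\<close> keeps admissibility iff \<open>y\<^sub>n < R\<^sub>n\<^sub>+\<^sub>1\<close>, and \<open>1\<close> keeps it iff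
  \<open>p\<^sub>n\<^sub>+\<^sub>1 < y\<^sub>n\<close>. The hypothesis \<open>cond2\<close> says \<open>p\<^sub>n\<^sub>+\<^sub>1 < R\<^sub>n\<^sub>+\<^sub>1\<close>, so at least one digit is possible, and the greedy
  choice turns every admissible finite word into an expansion of \<open>x\<close> with only admissible remainders
  (\<open>greedy_continuation\<close>). Such expansions are called interior. Both digits are possible iff
  \<open>p\<^sub>n\<^sub>+\<^sub>1 < y\<^sub>n < R\<^sub>n\<^sub>+\<^sub>1\<close>; then the expansion branches at \<open>n\<close>.

  The heart of the proof is that every interior expansion branches at arbitrarily late positions
  (\<open>branch_point_exists\<close>). Suppose that there is no branching from some point on. Then a digit
  \<open>c\<^sub>n = 0\<close> forces \<open>y\<^sub>n \<le> p\<^sub>n\<close>, and a digit \<open>c\<^sub>n = 1\<close> forces \<open>R\<^sub>n - y\<^sub>n \<le> p\<^sub>n\<close>. Let \<open>n\<close> be an index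
  as in \<open>cond3\<close>, so \<open>p\<^sub>n\<^sub>-\<^sub>1 < R\<^sub>n\<close>, and suppose \<open>c\<^sub>n = 0\<close>. If the last earlier digit \<open>1\<close> is \<open>c\<^sub>j\<close>, then
  \<open>y\<^sub>j = y\<^sub>n \<le> p\<^sub>n\<close>, while by \<open>cond4\<close>
  \<open>R\<^sub>j = p\<^sub>j\<^sub>+\<^sub>1 + \<dots> + p\<^sub>n + R\<^sub>n > (p\<^sub>j\<^sub>+\<^sub>1 + \<dots> + p\<^sub>n\<^sub>-\<^sub>1 + p\<^sub>n\<^sub>-\<^sub>1) + p\<^sub>n \<ge> p\<^sub>j + p\<^sub>n\<close>
  (the bracket being read as \<open>p\<^sub>j\<close> if \<open>j = n - 1\<close>),
  which contradicts \<open>R\<^sub>j - y\<^sub>j \<le> p\<^sub>j\<close>. Hence all earlier digits in the range considered are \<open>0\<close>; the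
  reflection \<open>y\<^sub>n \<mapsto> R\<^sub>n - y\<^sub>n\<close> exchanges the digits and gives the same for \<open>1\<close>. As there are
  infinitely many such \<open>n\<close>, the digits are eventually constant, which positivity of \<open>y\<^sub>n\<close> together with
  \<open>y\<^sub>n \<rightarrow> 0\<close> rules out for \<open>0\<close>, and \<open>y\<^sub>n < R\<^sub>n\<close> for \<open>1\<close>.

  Flipping the digit at a late branch point and continuing greedily shows that no interior
  expansion is isolated among the interior ones. They form a nonempty \<open>G\<^sub>\<delta>\<close> set in the Cantor space,
  and such a set without isolated points has the cardinality of the continuum. General expansions
  would not do: one whose digits are eventually \<open>0\<close> is isolated.\<close>

section \<open>Perfect subsets of the Cantor space\<close>

text \<open>A \<open>G\<^sub>\<delta>\<close> subset of a completely metrizable space is itself completely metrizable, and as a space of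
  its own it is perfect when it has no isolated points. Basic open sets of the Cantor space restrict
  finitely many digits, so being non-isolated means that every prefix is shared with another point.\<close>

lemma continuum_le_gdelta_without_isolated_points:
  fixes V :: "(nat \<Rightarrow> nat) set"
  assumes gdelta: "gdelta_in (product_topology (\<lambda>_. discrete_topology {0, 1}) {1..}) V"
    and nonempty: "V \<noteq> {}"
    and not_isolated: "\<And>c n. c \<in> V \<Longrightarrow> \<exists>c'\<in>V. c' \<noteq> c \<and> (\<forall>i\<in>{1..n}. c' i = c i)"
  shows "(UNIV :: real set) \<lesssim> V"
proof -
  define X :: "(nat \<Rightarrow> nat) topology"
    where "X = product_topology (\<lambda>_. discrete_topology {0, 1}) {1..}"
  have V_sub: "V \<subseteq> topspace X"
    using gdelta gdelta_in_subset unfolding X_def by blast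
  have "completely_metrizable_space X"
    unfolding X_def completely_metrizable_space_product_topology
    by (simp add: completely_metrizable_space_discrete_topology)
  hence metr: "completely_metrizable_space (subtopology X V)"
    using gdelta completely_metrizable_space_gdelta_in unfolding X_def by blast
  have "V \<subseteq> X derived_set_of V"
  proof
    fix c assume c: "c \<in> V"
    have "\<exists>c'. c' \<noteq> c \<and> c' \<in> V \<and> c' \<in> T" if T: "c \<in> T" "openin X T" for T
    proof -
      obtain U where U: "finite {i \<in> {1..}. U i \<noteq> {0, 1::nat}}" "c \<in> Pi\<^sub>E {1..} U" "Pi\<^sub>E {1..} U \<subseteq> T"
        using bspec[OF iffD1[OF openin_product_topology_alt T(2)[unfolded X_def]] T(1)]
        unfolding topspace_discrete_topology by (elim exE conjE) (rule that)
      obtain n where "{i \<in> {1..}. U i \<noteq> {0, 1::nat}} \<subseteq> {..n}"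
        using U(1) unfolding finite_nat_iff_bounded_le by (elim exE) (rule that)
      hence n: "i \<le> n" if "i \<in> {1..}" "U i \<noteq> {0, 1}" for i
        using that by auto
      obtain c' where c': "c' \<in> V" "c' \<noteq> c" "\<forall>i\<in>{1..n}. c' i = c i"
        using not_isolated[OF c] by blast
      have c'PiE: "c' \<in> Pi\<^sub>E {1..} (\<lambda>_. {0, 1})"
        using subsetD[OF V_sub c'(1)] unfolding X_def by simp
      have c'01: "c' i \<in> {0, 1}" if "i \<in> {1..}" for i
        using c'PiE that by (rule PiE_mem)
      have "c' i \<in> U i" if i: "i \<in> {1..}" for i
      proof (cases "U i = {0, 1}")
        case True
        thus ?thesis using c'01[OF i] by simp
      next
        case False
        thus ?thesis using PiE_mem[OF U(2) i] n[OF i] c'(3) i by simp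
      qed
      hence "c' \<in> Pi\<^sub>E {1..} U"
        using c'PiE by (simp add: PiE_iff)
      thus ?thesis using U(3) c' by blast
    qed
    thus "c \<in> X derived_set_of V"
      using c V_sub by (auto simp: in_derived_set_of)
  qed
  hence "subtopology X V derived_set_of V = V"
    by (auto simp: derived_set_of_subtopology)
  thus ?thesis
    using lepoll_perfect_set metr nonempty by blast
qed

section \<open>Remainders and interior expansions\<close>

definition remainder :: "(nat \<Rightarrow> real) \<Rightarrow> real \<Rightarrow> (nat \<Rightarrow> nat) \<Rightarrow> nat \<Rightarrow> real" where
  "remainder p x c n = x - (\<Sum>i=1..n. real (c i) * p i)"

definition admissible :: "(nat \<Rightarrow> real) \<Rightarrow> nat \<Rightarrow> real \<Rightarrow> bool" where
  "admissible p n y \<longleftrightarrow> 0 < y \<and> ennreal y < tail_sum p (n + 1)"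

text \<open>For divergent \<open>\<Sum>p\<close> every positive remainder is admissible, and the digits may exhaust less than
  \<open>x\<close>; the limit excludes this.\<close>

definition interior_expansions :: "(nat \<Rightarrow> real) \<Rightarrow> real \<Rightarrow> (nat \<Rightarrow> nat) set" where
  "interior_expansions p x =
     {c \<in> {1..} \<rightarrow>\<^sub>E {0, 1}. (\<forall>n. admissible p n (remainder p x c n)) \<and> remainder p x c \<longlonglongrightarrow> 0}"

lemma remainder_0 [simp]: "remainder p x c 0 = x"
  by (simp add: remainder_def)

lemma remainder_Suc: "remainder p x c (Suc n) = remainder p x c n - real (c (Suc n)) * p (Suc n)"
  by (simp add: remainder_def)

lemma remainder_cong:
  assumes "\<And>i. 1 \<le> i \<Longrightarrow> i \<le> n \<Longrightarrow> c i = c' i"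
  shows "remainder p x c n = remainder p x c' n"
  unfolding remainder_def using assms by (auto intro!: sum.cong)

lemma tail_sum_unfold: "tail_sum p n = ennreal (p n) + tail_sum p (Suc n)"
  unfolding tail_sum_def
  using suminf_offset[of "\<lambda>i. ennreal (p (n + i))" 1] by (simp add: add_ac)

lemma interior_expansions_subset: "interior_expansions p x \<subseteq> expansions p x"
proof
  fix c assume c: "c \<in> interior_expansions p x"
  have "(\<Sum>i<n. real (c (i + 1)) * p (i + 1)) = x - remainder p x c n" for n
    by (induction n) (auto simp: remainder_Suc)
  moreover have "(\<lambda>n. x - remainder p x c n) \<longlonglongrightarrow> x - 0"
    using c by (intro tendsto_intros) (simp add: interior_expansions_def)
  ultimately have "(\<lambda>i. real (c (i + 1)) * p (i + 1)) sums x"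
    by (simp add: sums_def)
  thus "c \<in> expansions p x"
    using c by (simp add: expansions_def interior_expansions_def)
qed

lemma remainder_tendsto_0:
  assumes pos: "\<And>i. i \<ge> 1 \<Longrightarrow> p i > 0"
    and adm: "\<And>n. admissible p n (remainder p x c n)"
    and small: "\<And>e. e > 0 \<Longrightarrow> \<exists>n. remainder p x c n < e"
  shows "remainder p x c \<longlonglongrightarrow> 0"
proof (rule LIMSEQ_I)
  fix e :: real assume "e > 0"
  then obtain n where n: "remainder p x c n < e" using small by blast
  have "decseq (remainder p x c)"
    unfolding decseq_Suc_iff using pos by (auto simp: remainder_Suc less_imp_le)
  hence "norm (remainder p x c m - 0) < e" if "m \<ge> n" for m
    using decseqD[of "remainder p x c" n m] that adm[of m] n by (simp add: admissible_def)
  thus "\<exists>n. \<forall>m\<ge>n. norm (remainder p x c m - 0) < e" by blast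
qed

text \<open>Admissibility of each remainder is an open condition on the digits. Since admissible remainders
  decrease and stay positive, convergence to \<open>0\<close> only asks that for each \<open>k\<close> some remainder is below
  \<open>1 / (k + 1)\<close>, which is again open. For divergent \<open>\<Sum>p\<close> the set is in general not closed, as
  digits \<open>1\<close> can move off to infinity.\<close>

lemma gdelta_interior_expansions:
  assumes pos: "\<And>i. i \<ge> 1 \<Longrightarrow> p i > 0"
  shows "gdelta_in (product_topology (\<lambda>_. discrete_topology {0, 1}) {1..}) (interior_expansions p x)"
proof -
  define X :: "(nat \<Rightarrow> nat) topology"
    where "X = product_topology (\<lambda>_. discrete_topology {0, 1}) {1..}"
  have top: "topspace X = {1..} \<rightarrow>\<^sub>E {0, 1}" by (simp add: X_def)
  have cont: "continuous_map X euclideanreal (\<lambda>c. remainder p x c n)" for n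
  proof -
    have "continuous_map X euclideanreal (\<lambda>c. real (c i))" if "i \<in> {1..n}" for i
    proof -
      have "continuous_map X (discrete_topology {0, 1}) (\<lambda>c. c i)"
        unfolding X_def using that
        by (intro continuous_map_product_projection[of _ "{1..}" "\<lambda>_. discrete_topology {0, 1}", simplified]) auto
      from continuous_map_compose[OF this, of euclideanreal real]
      show ?thesis by (simp add: o_def)
    qed
    thus ?thesis
      unfolding remainder_def
      by (intro continuous_map_diff continuous_map_sum continuous_map_real_mult) auto
  qed
  define A where "A n = {c \<in> topspace X. remainder p x c n \<in> {y. admissible p n y}}" for n
  define B where "B k n = {c \<in> topspace X. remainder p x c n \<in> {..<1 / real (Suc k)}}" for k n
  have "open {y. admissible p n y}" for n
  proof -
    have "open {y. ennreal y < tail_sum p (n + 1)}"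
      by (intro open_Collect_less continuous_on_ennreal continuous_on_id continuous_on_const)
    moreover have "open {y::real. 0 < y}" by (intro open_Collect_less continuous_intros)
    ultimately show ?thesis by (simp add: admissible_def open_Collect_conj)
  qed
  hence A: "openin X (A n)" for n
    unfolding A_def by (intro openin_continuous_map_preimage[OF cont]) auto
  have B: "openin X (B k n)" for k n
    unfolding B_def by (intro openin_continuous_map_preimage[OF cont]) auto
  have "interior_expansions p x = (\<Inter>n. A n) \<inter> (\<Inter>k. \<Union>n. B k n)"
  proof (intro equalityI subsetI)
    fix c assume c: "c \<in> interior_expansions p x"
    have "\<exists>n. remainder p x c n < 1 / real (Suc k)" for k
    proof -
      have "remainder p x c \<longlonglongrightarrow> 0" using c by (simp add: interior_expansions_def)
      hence "\<forall>\<^sub>F n in sequentially. remainder p x c n < 1 / real (Suc k)"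
        by (rule order_tendstoD) simp
      thus ?thesis by (auto simp: eventually_sequentially)
    qed
    thus "c \<in> (\<Inter>n. A n) \<inter> (\<Inter>k. \<Union>n. B k n)"
      using c by (auto simp: A_def B_def top interior_expansions_def)
  next
    fix c assume c: "c \<in> (\<Inter>n. A n) \<inter> (\<Inter>k. \<Union>n. B k n)"
    have adm: "admissible p n (remainder p x c n)" for n
      using c by (auto simp: A_def)
    have "remainder p x c \<longlonglongrightarrow> 0"
    proof (rule remainder_tendsto_0[OF pos adm])
      fix e :: real assume "e > 0"
      then obtain k where k: "1 / real (Suc k) < e"
        using nat_approx_posE by blast
      moreover obtain n where "remainder p x c n < 1 / real (Suc k)"
        using c by (auto simp: B_def)
      ultimately show "\<exists>n. remainder p x c n < e" by (meson less_trans)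
    qed
    thus "c \<in> interior_expansions p x"
      using c adm by (auto simp: A_def top interior_expansions_def)
  qed
  moreover have "gdelta_in X (\<Inter>n. A n)"
    by (intro gdelta_in_Inter) (auto intro: open_imp_gdelta_in A)
  moreover have "gdelta_in X (\<Inter>k. \<Union>n. B k n)"
    by (intro gdelta_in_Inter) (auto intro!: open_imp_gdelta_in B openin_Union)
  ultimately show ?thesis
    unfolding X_def[symmetric] by (simp add: gdelta_in_Int)
qed

section \<open>Greedy continuation\<close>

text \<open>Taking every term from \<open>p (n + 1)\<close> on would use up the whole tail, finite or not, but an admissible
  remainder is smaller than the tail.\<close>

lemma not_eventually_all_ones:
  assumes pos: "\<And>i. i \<ge> 1 \<Longrightarrow> p i > 0"
    and adm: "\<And>m. m \<ge> n \<Longrightarrow> admissible p m (remainder p x c m)"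
  shows "\<exists>i>n. c i \<noteq> 1"
proof (rule ccontr)
  assume "\<not> (\<exists>i>n. c i \<noteq> 1)"
  hence "remainder p x c (n + k) = remainder p x c n - (\<Sum>i<k. p (n + 1 + i))" for k
    by (induction k) (auto simp: remainder_Suc)
  hence "(\<Sum>i<k. p (n + 1 + i)) \<le> remainder p x c n" for k
    using adm[of "n + k"] by (simp add: admissible_def)
  moreover have "(\<Sum>i<k. ennreal (p (n + 1 + i))) = ennreal (\<Sum>i<k. p (n + 1 + i))" for k
    using pos by (intro sum_ennreal) (simp add: less_imp_le)
  ultimately have "(\<Sum>i<k. ennreal (p (n + 1 + i))) \<le> ennreal (remainder p x c n)" for k
    by (simp only: ennreal_leI)
  hence "tail_sum p (n + 1) \<le> ennreal (remainder p x c n)"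
    unfolding tail_sum_def by (intro suminf_le_const summableI) auto
  thus False using adm[of n] unfolding admissible_def by (meson leD order_refl)
qed

lemma admissible_digit_1:
  assumes "admissible p n y" "p (Suc n) < y" "p (Suc n) > 0"
  shows "admissible p (Suc n) (y - p (Suc n))"
proof -
  have "ennreal (y - p (Suc n)) + ennreal (p (Suc n)) < tail_sum p (Suc (Suc n)) + ennreal (p (Suc n))"
    using assms by (subst ennreal_plus[symmetric])
      (auto simp: admissible_def tail_sum_unfold[of p "Suc n"] add.commute)
  thus ?thesis using assms by (auto simp: admissible_def)
qed

text \<open>The \<open>k\<close>-th remainder when the greedy digits start after position \<open>n\<close> with remainder \<open>y\<close>. The
  comparison is strict because taking \<open>p\<close> from an equal remainder would leave the inadmissible \<open>0\<close>.\<close>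

primrec greedy_remainder :: "(nat \<Rightarrow> real) \<Rightarrow> nat \<Rightarrow> real \<Rightarrow> nat \<Rightarrow> real" where
  "greedy_remainder p n y 0 = y"
| "greedy_remainder p n y (Suc k) = greedy_remainder p n y k
     - (if p (Suc (n + k)) < greedy_remainder p n y k then p (Suc (n + k)) else 0)"

text \<open>A greedy digit \<open>1\<close> keeps admissibility since remainder and tail lose the same amount; a digit \<open>0\<close>
  keeps it since then the remainder is at most the current term, which is less than the next tail.\<close>

lemma greedy_continuation:
  assumes pos: "\<And>i. i \<ge> 1 \<Longrightarrow> p i > 0"
    and null: "p \<longlonglongrightarrow> 0"
    and tail: "\<And>n. n \<ge> 1 \<Longrightarrow> ennreal (p n) < tail_sum p (n + 1)"
    and digits: "\<And>i. 1 \<le> i \<Longrightarrow> i \<le> n \<Longrightarrow> c i \<in> {0, 1}"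
    and adm: "\<And>m. m \<le> n \<Longrightarrow> admissible p m (remainder p x c m)"
  obtains c' where "c' \<in> interior_expansions p x" "\<And>i. 1 \<le> i \<Longrightarrow> i \<le> n \<Longrightarrow> c' i = c i"
proof -
  define g where "g = greedy_remainder p n (remainder p x c n)"
  define c' where "c' = (\<lambda>i\<in>{1..}. if i \<le> n then c i else of_bool (p i < g (i - n - 1)))"
  have prefix: "c' i = c i" if "1 \<le> i" "i \<le> n" for i
    using that by (simp add: c'_def)
  have rem_prefix: "remainder p x c' m = remainder p x c m" if "m \<le> n" for m
    using that prefix by (intro remainder_cong) auto
  have rem_greedy: "remainder p x c' (n + k) = g k" for k
  proof (induction k)
    case 0
    show ?case by (simp add: rem_prefix g_def)
  next
    case (Suc k)
    thus ?case by (auto simp: remainder_Suc c'_def g_def)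
  qed
  have adm_g: "admissible p (n + k) (g k)" for k
  proof (induction k)
    case 0
    show ?case using adm[of n] by (simp add: g_def)
  next
    case (Suc k)
    show ?case
    proof (cases "p (Suc (n + k)) < g k")
      case True
      thus ?thesis using admissible_digit_1[OF Suc True] pos by (simp add: g_def)
    next
      case False
      hence "ennreal (g k) \<le> ennreal (p (Suc (n + k)))" by (simp add: ennreal_leI)
      also have "\<dots> < tail_sum p (Suc (n + k) + 1)" by (intro tail) auto
      finally show ?thesis using False Suc by (simp add: g_def admissible_def)
    qed
  qed
  have adm': "admissible p m (remainder p x c' m)" for m
  proof (cases "m \<le> n")
    case True
    thus ?thesis using adm rem_prefix by simp
  next
    case False
    thus ?thesis using rem_greedy[of "m - n"] adm_g[of "m - n"] by simp
  qed
  have "remainder p x c' \<longlonglongrightarrow> 0"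
  proof (rule remainder_tendsto_0[OF pos adm'])
    fix e :: real assume "e > 0"
    hence "\<forall>\<^sub>F i in sequentially. p i < e" by (rule order_tendstoD[OF null])
    then obtain M where M: "\<And>i. i \<ge> M \<Longrightarrow> p i < e" by (auto simp: eventually_sequentially)
    \<comment> \<open>A digit \<open>0\<close> is written only when the remainder does not exceed the current term, so a
      late digit \<open>0\<close> certifies a small remainder.\<close>
    obtain i where i: "i > max M n" "c' i \<noteq> 1"
      using not_eventually_all_ones[of p "max M n" x c'] pos adm' by blast
    define k where "k = i - n - 1"
    have "\<not> p i < g k" using i by (auto simp: c'_def k_def)
    thus "\<exists>m. remainder p x c' m < e"
      using M[of i] i rem_greedy[of k] by (intro exI[of _ "n + k"]) simp
  qed
  moreover have "c' \<in> {1..} \<rightarrow>\<^sub>E {0, 1}"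
    using digits by (auto simp: c'_def)
  ultimately show ?thesis
    using that[of c'] adm' prefix by (simp add: interior_expansions_def)
qed

section \<open>Branch points\<close>

text \<open>Going down from \<open>n\<close>, the inequality \<open>p j + p (n + 1) < r j\<close> is kept: passing from \<open>j\<close> to
  \<open>j - 1\<close> adds \<open>p j\<close> on the right, and \<open>2 * p j\<close> bounds \<open>p (j - 1)\<close>. As long as only zeros were met, the
  remainder is still \<open>y (n + 1)\<close>, which is at most \<open>p (n + 1)\<close>; so \<open>r j - y j\<close> exceeds \<open>p j\<close> and a digit
  \<open>1\<close> (\<open>d j\<close> true) is impossible at \<open>j\<close>.\<close>

lemma forced_zeros_propagate_back:
  fixes p r y :: "nat \<Rightarrow> real" and d :: "nat \<Rightarrow> bool"
  assumes tail: "\<And>m. m \<ge> N \<Longrightarrow> r m = p (Suc m) + r (Suc m)"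
    and remain: "\<And>m. m \<ge> N \<Longrightarrow> y m = y (Suc m) + (if d (Suc m) then p (Suc m) else 0)"
    and zero: "\<And>m. m > N \<Longrightarrow> \<not> d m \<Longrightarrow> y m \<le> p m"
    and one: "\<And>m. m > N \<Longrightarrow> d m \<Longrightarrow> r m - y m \<le> p m"
    and double: "\<And>m. m \<ge> N \<Longrightarrow> p m \<le> 2 * p (Suc m)"
    and good: "p n < r (Suc n)"
    and last: "\<not> d (Suc n)"
    and j: "N < j" "j \<le> Suc n"
  shows "\<not> d j"
proof -
  have key: "y j = y (Suc n) \<and> p j + p (Suc n) < r j \<and> \<not> d j" if "j \<le> n" "N < j" for j
    using that
  proof (induction rule: inc_induct)
    case base
    have "y n = y (Suc n)" "p n + p (Suc n) < r n"
      using remain[of n] tail[of n] last good base by auto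
    thus ?case using one[of n] zero[of "Suc n"] last base by force
  next
    case (step j)
    have "y j = y (Suc n)" "p j + p (Suc n) < r j"
      using step remain[of j] tail[of j] double[of j] by auto
    thus ?case using one[of j] zero[of "Suc n"] last step by force
  qed
  show ?thesis
    using key[of j] last j by (cases "j = Suc n") auto
qed

lemma forced_digits_constant:
  fixes p r y :: "nat \<Rightarrow> real" and d :: "nat \<Rightarrow> bool"
  assumes tail: "\<And>m. m \<ge> N \<Longrightarrow> r m = p (Suc m) + r (Suc m)"
    and remain: "\<And>m. m \<ge> N \<Longrightarrow> y m = y (Suc m) + (if d (Suc m) then p (Suc m) else 0)"
    and zero: "\<And>m. m > N \<Longrightarrow> \<not> d m \<Longrightarrow> y m \<le> p m"
    and one: "\<And>m. m > N \<Longrightarrow> d m \<Longrightarrow> r m - y m \<le> p m"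
    and double: "\<And>m. m \<ge> N \<Longrightarrow> p m \<le> 2 * p (Suc m)"
    and good: "p n < r (Suc n)"
    and j: "N < j" "j \<le> Suc n"
  shows "d j = d (Suc n)"
proof (cases "d (Suc n)")
  case False
  thus ?thesis
    using forced_zeros_propagate_back[of N r p y d n j] assms by blast
next
  case True
  \<comment> \<open>The hypotheses are invariant under exchanging the digits and \<open>y\<close> with \<open>r - y\<close>.\<close>
  have "\<not> \<not> d j"
  proof (rule forced_zeros_propagate_back[of N r p "\<lambda>m. r m - y m" "\<lambda>m. \<not> d m" n j])
    show "r m = p (Suc m) + r (Suc m)" if "m \<ge> N" for m using tail[OF that] .
    show "r m - y m = r (Suc m) - y (Suc m) + (if \<not> d (Suc m) then p (Suc m) else 0)"
      if "m \<ge> N" for m using remain[OF that] tail[OF that] by simp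
  qed (use zero one double good True j in auto)
  thus ?thesis using True by simp
qed

text \<open>Without branching from \<open>n\<close> on, admissibility forces every later digit, which is the situation of
  \<open>forced_digits_constant\<close>. A forced digit \<open>1\<close> bounds a tail by a real number, so the tails are finite and
  real arithmetic applies.\<close>

lemma branch_point_exists:
  assumes pos: "\<And>i. i \<ge> 1 \<Longrightarrow> p i > 0"
    and good: "infinite {n. n \<ge> 2 \<and> ennreal (p (n - 1)) < tail_sum p (n + 1)}"
    and double: "\<forall>\<^sub>F n in sequentially. p n \<le> 2 * p (n + 1)"
    and c: "c \<in> interior_expansions p x"
  shows "\<exists>m\<ge>n. p (Suc m) < remainder p x c m \<and>
    ennreal (remainder p x c m) < tail_sum p (Suc (Suc m))"
proof (rule ccontr)
  define y where "y = remainder p x c"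
  define R where "R m = tail_sum p (Suc m)" for m
  assume "\<not> ?thesis"
  hence forced: "y m \<le> p (Suc m) \<or> R (Suc m) \<le> ennreal (y m)" if "m \<ge> n" for m
    using that by (auto simp: y_def R_def not_less)
  have adm: "0 < y m" "ennreal (y m) < R m" for m
    using c by (auto simp: interior_expansions_def admissible_def y_def R_def)
  have c01: "c i \<noteq> 0 \<Longrightarrow> c i = 1" if "i \<ge> 1" for i
    using c that PiE_mem[of c "{1..}" "\<lambda>_. {0, 1}" i] by (auto simp: interior_expansions_def)
  have R_Suc: "R m = ennreal (p (Suc m)) + R (Suc m)" for m
    unfolding R_def by (rule tail_sum_unfold)
  have y_Suc: "y m = y (Suc m) + (if c (Suc m) \<noteq> 0 then p (Suc m) else 0)" for m
    using c01[of "Suc m"] by (auto simp: y_def remainder_Suc)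
  obtain N0 where N0: "\<And>m. m \<ge> N0 \<Longrightarrow> p m \<le> 2 * p (Suc m)"
    using double by (auto simp: eventually_sequentially)
  define N where "N = max n (max N0 1)"
  have zero: "y m \<le> p m" if m: "m > N" "c m = 0" for m
  proof -
    obtain k where k: "m = Suc k" "k \<ge> n" using m by (cases m) (auto simp: N_def)
    have "y k = y m" using y_Suc[of k] m k by simp
    thus ?thesis using forced[OF k(2)] adm(2)[of m] k by auto
  qed
  have one: "R m \<le> ennreal (y m + p m)" if m: "m > N" "c m \<noteq> 0" for m
  proof -
    obtain k where k: "m = Suc k" "k \<ge> n" using m by (cases m) (auto simp: N_def)
    have "y k = y m + p m" using y_Suc[of k] m k by simp
    thus ?thesis using forced[OF k(2)] adm(1)[of m] k by auto
  qed
  have some_zero: "\<exists>i>M. c i = 0" for M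
  proof -
    obtain i where "i > M" "c i \<noteq> 1"
      using not_eventually_all_ones[of p M x c] pos c by (auto simp: interior_expansions_def)
    thus ?thesis using c01[of i] by (cases "c i = 0") auto
  qed
  have some_one: "\<exists>i>M. c i \<noteq> 0" for M
  proof (rule ccontr)
    assume no_ones: "\<not> ?thesis"
    have const: "y (k + M) = y M" for k
    proof (induction k)
      case (Suc k)
      thus ?case using y_Suc[of "k + M"] no_ones by simp
    qed simp
    have "y \<longlonglongrightarrow> 0" using c by (simp add: interior_expansions_def y_def)
    hence "(\<lambda>k. y (k + M)) \<longlonglongrightarrow> 0" by (rule LIMSEQ_ignore_initial_segment)
    hence "y M = 0" by (simp add: const LIMSEQ_const_iff)
    thus False using adm(1)[of M] by simp
  qed
  obtain i where i: "i > N" "c i \<noteq> 0" using some_one by blast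
  have "R m < top" for m
  proof -
    have "R i < top" using one[OF i] by (simp add: le_less_trans)
    have "R 0 < top"
    proof -
      have "R m < top \<Longrightarrow> R 0 < top" for m
      proof (induction m)
        case (Suc m)
        thus ?case using R_Suc[of m] by simp
      qed
      thus ?thesis using \<open>R i < top\<close> by blast
    qed
    thus ?thesis
    proof (induction m)
      case (Suc m)
      thus ?case using R_Suc[of m] by (auto simp: less_top)
    qed
  qed
  hence fin: "R m = ennreal (enn2real (R m))" for m by simp
  define r where "r m = enn2real (R m)" for m
  have r_nonneg: "r m \<ge> 0" for m by (simp add: r_def)
  have R_r: "R m = ennreal (r m)" for m using fin by (simp add: r_def)
  have r_Suc: "r m = p (Suc m) + r (Suc m)" for m
    using R_Suc[of m] pos[of "Suc m"] r_nonneg[of m] r_nonneg[of "Suc m"]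
    by (simp add: R_r flip: ennreal_plus)
  \<comment> \<open>A good index beyond both a digit \<open>1\<close> and a digit \<open>0\<close> forces these two digits to be equal.\<close>
  obtain z where z: "z > N" "c z = 0" using some_zero by blast
  obtain g where "g > max i z" "g \<in> {n. n \<ge> 2 \<and> ennreal (p (n - 1)) < tail_sum p (n + 1)}"
    using good unfolding infinite_nat_iff_unbounded by blast
  hence g: "g > max i z" "g \<ge> 2" "ennreal (p (g - 1)) < R g"
    by (auto simp: R_def)
  then obtain h where h: "g = Suc h" by (cases g) auto
  have "(c j \<noteq> 0) = (c (Suc h) \<noteq> 0)" if "N < j" "j \<le> Suc h" for j
  proof (rule forced_digits_constant[of N r p y "\<lambda>i. c i \<noteq> 0" h j])
    show "r m = p (Suc m) + r (Suc m)" for m by (rule r_Suc)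
    show "y m = y (Suc m) + (if c (Suc m) \<noteq> 0 then p (Suc m) else 0)" for m by (rule y_Suc)
    show "y m \<le> p m" if "m > N" "\<not> c m \<noteq> 0" for m using zero that by simp
    show "p m \<le> 2 * p (Suc m)" if "m \<ge> N" for m using N0 that by (simp add: N_def)
    show "r m - y m \<le> p m" if "m > N" "c m \<noteq> 0" for m
    proof -
      have "ennreal (r m) \<le> ennreal (y m + p m)" using one[OF that] by (simp only: R_r)
      hence "r m \<le> y m + p m"
        using adm(1)[of m] pos[of m] that by (subst (asm) ennreal_le_iff) auto
      thus ?thesis by simp
    qed
    show "p h < r (Suc h)"
      using g h pos[of h] by (simp add: R_r ennreal_less_iff)
  qed (use that in auto)
  from this[of i] this[of z] show False
    using i z g h by simp
qed

lemma interior_expansion_not_isolated: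
  assumes pos: "\<And>i. i \<ge> 1 \<Longrightarrow> p i > 0"
    and null: "p \<longlonglongrightarrow> 0"
    and tail: "\<And>n. n \<ge> 1 \<Longrightarrow> ennreal (p n) < tail_sum p (n + 1)"
    and good: "infinite {n. n \<ge> 2 \<and> ennreal (p (n - 1)) < tail_sum p (n + 1)}"
    and double: "\<forall>\<^sub>F n in sequentially. p n \<le> 2 * p (n + 1)"
    and c: "c \<in> interior_expansions p x"
  shows "\<exists>c'\<in>interior_expansions p x. c' \<noteq> c \<and> (\<forall>i\<in>{1..n}. c' i = c i)"
proof -
  define y where "y = remainder p x c"
  obtain m where m: "m \<ge> n" "p (Suc m) < y m" "ennreal (y m) < tail_sum p (Suc (Suc m))"
    using branch_point_exists[OF pos good double c] unfolding y_def by blast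
  have adm: "admissible p k (y k)" for k
    using c by (simp add: interior_expansions_def y_def)
  have c01: "c i \<in> {0, 1}" if "i \<ge> 1" for i
    using c that PiE_mem[of c "{1..}" "\<lambda>_. {0, 1}" i] by (auto simp: interior_expansions_def)
  define b where "b = c(Suc m := 1 - c (Suc m))"
  have rem_b: "remainder p x b k = y k" if "k \<le> m" for k
    unfolding y_def using that by (intro remainder_cong) (auto simp: b_def)
  have b_last: "b (Suc m) = 0 \<or> b (Suc m) = 1"
    using c01[of "Suc m"] by (auto simp: b_def)
  have "admissible p k (remainder p x b k)" if "k \<le> Suc m" for k
  proof (cases "k = Suc m")
    case False
    thus ?thesis using that adm rem_b by simp
  next
    case True
    have "admissible p (Suc m) (y m)"
      using adm[of m] m by (simp add: admissible_def)
    moreover have "admissible p (Suc m) (y m - p (Suc m))"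
      using admissible_digit_1[OF adm m(2)] pos by simp
    ultimately show ?thesis
      using b_last True by (auto simp: remainder_Suc rem_b)
  qed
  moreover have "b i \<in> {0, 1}" if "1 \<le> i" for i
    using c01[OF that] by (auto simp: b_def)
  ultimately obtain c' where c': "c' \<in> interior_expansions p x"
      "\<And>i. 1 \<le> i \<Longrightarrow> i \<le> Suc m \<Longrightarrow> c' i = b i"
    using greedy_continuation[of p "Suc m" b x] pos null tail by blast
  have "c' (Suc m) \<noteq> c (Suc m)"
    using c'(2)[of "Suc m"] c01[of "Suc m"] by (auto simp: b_def)
  hence "c' \<noteq> c" by blast
  moreover have "\<forall>i\<in>{1..n}. c' i = c i"
    using c'(2) m(1) by (simp add: b_def)
  ultimately show ?thesis using c'(1) by blast
qed

section \<open>Counting expansions\<close>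

lemma expansions_lepoll_continuum: "expansions p x \<lesssim> (UNIV :: real set)"
proof -
  have "inj_on (\<lambda>c. {i. c i = 1}) (expansions p x)"
  proof (rule inj_onI)
    fix c c' assume c: "c \<in> expansions p x" "c' \<in> expansions p x" "{i. c i = 1} = {i. c' i = 1}"
    have PiE: "c \<in> {1..} \<rightarrow>\<^sub>E {0, 1}" "c' \<in> {1..} \<rightarrow>\<^sub>E {0, 1}"
      using c(1,2) by (auto simp: expansions_def)
    show "c = c'"
    proof (rule PiE_ext[OF PiE])
      fix i :: nat assume "i \<in> {1..}"
      hence "c i \<in> {0, 1}" "c' i \<in> {0, 1}" using PiE by blast+
      moreover have "c i = 1 \<longleftrightarrow> c' i = 1" using c(3) by blast
      ultimately show "c i = c' i" by auto
    qed
  qed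
  hence "expansions p x \<lesssim> (UNIV :: nat set set)"
    unfolding lepoll_def by blast
  thus ?thesis
    using nat_sets_eqpoll_reals lepoll_trans eqpoll_imp_lepoll by blast
qed

theorem theorem1p4:
  fixes p :: "nat \<Rightarrow> real" and x :: real
  assumes pos: "\<And>i. i \<ge> 1 \<Longrightarrow> p i > 0"
    and cond1: "p \<longlonglongrightarrow> 0"
    and cond2: "\<And>n. n \<ge> 1 \<Longrightarrow> ennreal (p n) < tail_sum p (n + 1)"
    and cond3: "infinite {n. n \<ge> 2 \<and> ennreal (p (n - 1)) < tail_sum p (n + 1)}"
    and cond4: "\<forall>\<^sub>F n in sequentially. p n \<le> 2 * p (n + 1)"
    and x_pos: "0 < x"
    and x_less: "ennreal x < tail_sum p 1"
  shows "expansions p x \<approx> (UNIV :: real set)"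
proof (rule lepoll_antisym)
  show "expansions p x \<lesssim> (UNIV :: real set)"
    by (rule expansions_lepoll_continuum)
  obtain c where "c \<in> interior_expansions p x"
    using greedy_continuation[of p 0 undefined x] pos cond1 cond2 x_pos x_less
    by (auto simp: admissible_def)
  hence "(UNIV :: real set) \<lesssim> interior_expansions p x"
    using gdelta_interior_expansions[OF pos]
      interior_expansion_not_isolated[OF pos cond1 cond2 cond3 cond4]
    by (intro continuum_le_gdelta_without_isolated_points) auto
  also have "\<dots> \<lesssim> expansions p x"
    by (intro subset_imp_lepoll interior_expansions_subset)
  finally show "(UNIV :: real set) \<lesssim> expansions p x" .
qed

end
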